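(* Let $X=X_\sigma$ be an affine toric variety with cone $\sigma$, let $p$ be the primitive vector on a ray $\rho$ of $\sigma$, let $e_1,e_2$ be Demazure roots of $X_\sigma$ corresponding to $p$, and endow $X$ with the monoid structure of corank one given by the comultiplication $$\chi^u\mapsto\chi^u\otimes\chi^u\,(1\otimes\chi^{e_1}+\chi^{e_2}\otimes1)^{\langle p,u\rangle},\qquad u\in S_\sigma.$$ Then the monoid $X$ has a zero element if and only if $\sigma^\perp=0$ and $-e_1,-e_2\notin\sigma^\vee$. In such a case, the zero element equals $x_\sigma$.
   Context: The ground field $\mathbb K$ is algebraically closed of characteristic zero. $N$ is a lattice of rank $n$, $N_{\mathbb Q}=N\otimes_{\mathbb Z}\mathbb Q$, $M=\mathrm{Hom}(N,\mathbb Z)$, $M_{\mathbb Q}=M\otimes_{\mathbb Z}\mathbb Q$, with pairing $\langle\cdot,\cdot\rangle$. For a strongly convex polyhedral cone $\sigma\subseteq N_{\mathbb Q}$: $\sigma^\vee=\{u\in M_{\mathbb Q}\mid\langle v,u\rangle\ge0\ \forall v\in\sigma\}$, $\sigma^\perp=\{u\in M_{\mathbb Q}\mid\langle v,u\rangle=0\ \forall v\in\sigma\}$, $S_\sigma=M\cap\sigma^\vee$, $X_\sigma=\mathrm{Spec}\bigoplus_{u\in S_\sigma}\mathbb K\chi^u$ with $\chi^u\chi^{u'}=\chi^{u+u'}$. A ray is a one-dimensional face. If $p_1,\dots,p_m$ are the primitive lattice vectors on the rays of $\sigma$, a Demazure root corresponding to $p_i$ is $e\in M$ with $\langle p_i,e\rangle=-1$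 and $\langle p_j,e\rangle\ge0$ for $j\ne i$. The comultiplication is dual to the multiplication $(x,y)\mapsto x*y$; explicitly, $\chi^u(x*y)=\sum_{i+j=\langle p,u\rangle}\binom{\langle p,u\rangle}{i}\chi^{u+ie_2}(x)\chi^{u+je_1}(y)$. (This is an associative multiplication with unity, whose group of invertible elements has a maximal torus of codimension one.) Points of $X_\sigma$ correspond to semigroup homomorphisms $S_\sigma\to(\mathbb K,\cdot)$ (with $0\mapsto1$), $x\mapsto(u\mapsto\chi^u(x))$; the point $x_\sigma$ is given by $\chi^u(x_\sigma)=1$ if $u\in\sigma^\perp$ and $\chi^u(x_\sigma)=0$ otherwise. A zero element is an element $\mathbf 0\in X$ with $\mathbf 0*x=x*\mathbf 0=\mathbf 0$ for all $x\in X$. *)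

theory Defs
  imports "HOL-Analysis.Analysis" "HOL-Library.Poly_Mapping"
    "HOL-Computational_Algebra.Polynomial"
begin

text \<open>
  A basis of the lattice is fixed, so that N and M are both \<open>int ^ 'n\<close>, the spaces
  \<open>N\<^sub>Q\<close> and \<open>M\<^sub>Q\<close> are both \<open>rat ^ 'n\<close>, and the pairing is
  \<open>scalar_product\<close>.
\<close>

definition lat :: "int ^ 'n \<Rightarrow> rat ^ 'n" where
  "lat v = (\<chi> i. of_int (v $ i))"

subsection \<open>Cones\<close>

definition cone_hull :: "(rat ^ 'n) set \<Rightarrow> (rat ^ 'n) set" where
  "cone_hull S = {\<Sum>v\<in>S. c v *s v | c. \<forall>v\<in>S. 0 \<le> c v}"

definition polyhedral_cone :: "(rat ^ 'n) set \<Rightarrow> bool" where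
  "polyhedral_cone \<sigma> \<longleftrightarrow> (\<exists>S. finite S \<and> \<sigma> = cone_hull S)"

definition strongly_convex :: "(rat ^ 'n) set \<Rightarrow> bool" where
  "strongly_convex \<sigma> \<longleftrightarrow> \<sigma> \<inter> uminus ` \<sigma> = {0}"

definition dual_cone :: "(rat ^ 'n) set \<Rightarrow> (rat ^ 'n) set" where
  "dual_cone \<sigma> = {u. \<forall>v\<in>\<sigma>. 0 \<le> scalar_product v u}"

definition perp :: "(rat ^ 'n) set \<Rightarrow> (rat ^ 'n) set" where
  "perp \<sigma> = {u. \<forall>v\<in>\<sigma>. scalar_product v u = 0}"

definition is_face :: "(rat ^ 'n) set \<Rightarrow> (rat ^ 'n) set \<Rightarrow> bool" where
  "is_face \<tau> \<sigma> \<longleftrightarrow> (\<exists>u\<in>dual_cone \<sigma>. \<tau> = {v \<in> \<sigma>. scalar_product v u = 0})"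

definition is_ray :: "(rat ^ 'n) set \<Rightarrow> (rat ^ 'n) set \<Rightarrow> bool" where
  "is_ray \<rho> \<sigma> \<longleftrightarrow> is_face \<rho> \<sigma> \<and> vec.dim \<rho> = 1"

definition primitive :: "int ^ 'n \<Rightarrow> bool" where
  "primitive p \<longleftrightarrow> p \<noteq> 0 \<and> (\<forall>k q. p = k *s q \<longrightarrow> \<bar>k\<bar> = 1)"

definition primitive_on_ray :: "int ^ 'n \<Rightarrow> (rat ^ 'n) set \<Rightarrow> bool" where
  "primitive_on_ray p \<rho> \<longleftrightarrow> primitive p \<and> lat p \<in> \<rho>"

definition demazure_root :: "(rat ^ 'n) set \<Rightarrow> int ^ 'n \<Rightarrow> int ^ 'n \<Rightarrow> bool" where
  "demazure_root \<sigma> p e \<longleftrightarrow> scalar_product p e = -1 \<and>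
     (\<forall>\<rho> q. is_ray \<rho> \<sigma> \<longrightarrow> primitive_on_ray q \<rho> \<longrightarrow> q \<noteq> p \<longrightarrow> 0 \<le> scalar_product q e)"

subsection \<open>The toric variety\<close>

definition semigroup_of :: "(rat ^ 'n) set \<Rightarrow> (int ^ 'n) set" where
  "semigroup_of \<sigma> = {u. lat u \<in> dual_cone \<sigma>}"

text \<open>
  The group algebra of M is \<open>(int ^ 'n) \<Rightarrow>\<^sub>0 'k\<close>, with the convolution product; the
  coordinate algebra of the toric variety is the subalgebra of elements supported on the
  semigroup.
\<close>

definition chi :: "'a \<Rightarrow> 'a \<Rightarrow>\<^sub>0 'k::field" where
  "chi u = Poly_Mapping.single u 1"

definition coord_ring :: "(rat ^ 'n) set \<Rightarrow> ((int ^ 'n) \<Rightarrow>\<^sub>0 'k::field) set" where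
  "coord_ring \<sigma> = {f. Poly_Mapping.keys f \<subseteq> semigroup_of \<sigma>}"

text \<open>
  The points of the spectrum (over an algebraically closed field, the closed points) are the
  algebra homomorphisms from the coordinate algebra to the ground field; the value of a
  regular function \<open>f\<close> at a point \<open>x\<close> is \<open>x f\<close>. Homomorphisms are made extensional, so that
  equality of points is equality of functions. Taking \<open>c = 1\<close> in the condition on constants
  gives preservation of the unit.
\<close>

definition points :: "(rat ^ 'n) set \<Rightarrow> (((int ^ 'n) \<Rightarrow>\<^sub>0 'k::field) \<Rightarrow> 'k) set" where
  "points \<sigma> = {x \<in> extensional (coord_ring \<sigma>).
     (\<forall>c. x (Poly_Mapping.single 0 c) = c) \<and>
     (\<forall>f\<in>coord_ring \<sigma>. \<forall>g\<in>coord_ring \<sigma>. x (f + g) = x f + x g \<and> x (f * g) = x f * x g)}"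

text \<open>The point whose semigroup homomorphism \<open>u \<mapsto> x (chi u)\<close> is \<open>\<gamma>\<close>: its linear extension.\<close>

definition point_of_hom ::
    "(rat ^ 'n) set \<Rightarrow> (int ^ 'n \<Rightarrow> 'k::field) \<Rightarrow> ((int ^ 'n) \<Rightarrow>\<^sub>0 'k) \<Rightarrow> 'k" where
  "point_of_hom \<sigma> \<gamma> =
     restrict (\<lambda>f. \<Sum>u\<in>Poly_Mapping.keys f. Poly_Mapping.lookup f u * \<gamma> u) (coord_ring \<sigma>)"

definition x_sigma :: "(rat ^ 'n) set \<Rightarrow> ((int ^ 'n) \<Rightarrow>\<^sub>0 'k::field) \<Rightarrow> 'k" where
  "x_sigma \<sigma> = point_of_hom \<sigma> (\<lambda>u. if lat u \<in> perp \<sigma> then 1 else 0)"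

subsection \<open>The multiplication of corank one\<close>

text \<open>
  The tensor square of the group algebra of M is identified with the group algebra of
  \<open>M \<times> M\<close>, the tensor product of \<open>chi u\<close> and \<open>chi v\<close> being \<open>chi (u, v)\<close>. The factor
  \<open>1 \<otimes> \<chi>\<^bsup>e\<^sub>1\<^esup> + \<chi>\<^bsup>e\<^sub>2\<^esup> \<otimes> 1\<close> lives there, and not in the tensor square of the
  coordinate algebra.
\<close>

definition tensor :: "('a \<Rightarrow>\<^sub>0 'k::field) \<Rightarrow> ('b \<Rightarrow>\<^sub>0 'k) \<Rightarrow> ('a \<times> 'b) \<Rightarrow>\<^sub>0 'k" where
  "tensor f g = (\<Sum>a\<in>Poly_Mapping.keys f. \<Sum>b\<in>Poly_Mapping.keys g.
     Poly_Mapping.single (a, b) (Poly_Mapping.lookup f a * Poly_Mapping.lookup g b))"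

text \<open>The truncation \<open>nat\<close> is harmless: the pairing is nonnegative on the semigroup.\<close>

definition comult_chi ::
    "int ^ 'n \<Rightarrow> int ^ 'n \<Rightarrow> int ^ 'n \<Rightarrow> int ^ 'n \<Rightarrow> ((int ^ 'n) \<times> (int ^ 'n)) \<Rightarrow>\<^sub>0 'k::field" where
  "comult_chi p e1 e2 u =
     tensor (chi u) (chi u) * (tensor 1 (chi e1) + tensor (chi e2) 1) ^ nat (scalar_product p u)"

definition comult ::
    "int ^ 'n \<Rightarrow> int ^ 'n \<Rightarrow> int ^ 'n \<Rightarrow> ((int ^ 'n) \<Rightarrow>\<^sub>0 'k::field) \<Rightarrow> ((int ^ 'n) \<times> (int ^ 'n)) \<Rightarrow>\<^sub>0 'k" where
  "comult p e1 e2 f = (\<Sum>u\<in>Poly_Mapping.keys f.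
     Poly_Mapping.single 0 (Poly_Mapping.lookup f u) * comult_chi p e1 e2 u)"

text \<open>The value of an element of the tensor square at a pair of points.\<close>

definition eval_pair ::
    "(('a \<Rightarrow>\<^sub>0 'k) \<Rightarrow> 'k) \<Rightarrow> (('b \<Rightarrow>\<^sub>0 'k) \<Rightarrow> 'k) \<Rightarrow> (('a \<times> 'b) \<Rightarrow>\<^sub>0 'k::field) \<Rightarrow> 'k" where
  "eval_pair x y F =
     (\<Sum>(a, b)\<in>Poly_Mapping.keys F. Poly_Mapping.lookup F (a, b) * x (chi a) * y (chi b))"

definition mul ::
    "(rat ^ 'n) set \<Rightarrow> int ^ 'n \<Rightarrow> int ^ 'n \<Rightarrow> int ^ 'n \<Rightarrow>
     (((int ^ 'n) \<Rightarrow>\<^sub>0 'k::field) \<Rightarrow> 'k) \<Rightarrow> (((int ^ 'n) \<Rightarrow>\<^sub>0 'k) \<Rightarrow> 'k) \<Rightarrow>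
     ((int ^ 'n) \<Rightarrow>\<^sub>0 'k) \<Rightarrow> 'k" where
  "mul \<sigma> p e1 e2 x y = restrict (\<lambda>f. eval_pair x y (comult p e1 e2 f)) (coord_ring \<sigma>)"

definition is_zero_element :: "'x set \<Rightarrow> ('x \<Rightarrow> 'x \<Rightarrow> 'x) \<Rightarrow> 'x \<Rightarrow> bool" where
  "is_zero_element X m z \<longleftrightarrow> z \<in> X \<and> (\<forall>x\<in>X. m z x = z \<and> m x z = z)"

subsection \<open>Values on characters\<close>

lemma chi_in_coord_ring [simp]: "chi u \<in> coord_ring \<sigma> \<longleftrightarrow> u \<in> semigroup_of \<sigma>"
  by (simp add: chi_def coord_ring_def)

lemma x_sigma_chi:
  "u \<in> semigroup_of \<sigma> \<Longrightarrow> x_sigma \<sigma> (chi u) = (if lat u \<in> perp \<sigma> then 1 else 0)"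
  by (simp add: x_sigma_def point_of_hom_def) (simp add: chi_def)

lemma tensor_chi: "tensor (chi u) (chi v) = chi (u, v)"
  by (simp add: tensor_def chi_def)

lemma chi_mult: "chi u * chi v = chi (u + v)"
  by (simp add: chi_def mult_single)

lemma chi_zero: "chi 0 = 1"
  by (simp add: chi_def)

lemma chi_power: "chi (u :: 'a::comm_monoid_add) ^ k = chi (\<Sum>i<k. u)"
  by (induction k) (simp_all add: chi_zero chi_mult add.commute)

lemma eval_pair_superset:
  assumes "finite A" "Poly_Mapping.keys F \<subseteq> A"
  shows "eval_pair x y F = (\<Sum>(a, b)\<in>A. Poly_Mapping.lookup F (a, b) * x (chi a) * y (chi b))"
  unfolding eval_pair_def
  by (rule sum.mono_neutral_left) (use assms in \<open>auto simp: in_keys_iff\<close>)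

lemma eval_pair_add: "eval_pair x y (F + G) = eval_pair x y F + eval_pair x y G"
proof -
  let ?A = "Poly_Mapping.keys F \<union> Poly_Mapping.keys G"
  have "Poly_Mapping.keys (F + G) \<subseteq> ?A"
    by (rule Poly_Mapping.keys_add)
  then show ?thesis
    by (simp add: eval_pair_superset[of ?A] lookup_add algebra_simps split_beta flip: sum.distrib)
qed

lemma eval_pair_sum: "eval_pair x y (sum F I) = (\<Sum>i\<in>I. eval_pair x y (F i))"
  by (induction I rule: infinite_finite_induct) (simp_all add: eval_pair_add, simp_all add: eval_pair_def)

lemma eval_pair_of_nat_chi:
  "eval_pair x y (of_nat c * chi (a, b)) = of_nat c * x (chi a) * y (chi b)"
proof -
  have "of_nat c * chi (a, b) = Poly_Mapping.single (a, b) (of_nat c)"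
    by (simp add: chi_def mult_single flip: single_of_nat)
  show ?thesis
    unfolding \<open>of_nat c * chi (a, b) = _\<close> by (simp add: eval_pair_def)
qed

lemma mul_chi:
  assumes "u \<in> semigroup_of \<sigma>" and k: "k = nat (scalar_product p u)"
  shows "mul \<sigma> p e1 e2 x y (chi u) =
    (\<Sum>i\<le>k. of_nat (k choose i) * x (chi (u + int i *s e2)) * y (chi (u + int (k - i) *s e1)))"
proof -
  have "comult p e1 e2 (chi u) = (comult_chi p e1 e2 u :: _ \<Rightarrow>\<^sub>0 'b)"
    by (simp add: comult_def chi_def)
  also have "\<dots> = chi (u, u) * (chi (e2, 0) + chi (0, e1)) ^ k"
    using k by (simp add: comult_chi_def tensor_chi add.commute flip: chi_zero)
  also have "\<dots> = (\<Sum>i\<le>k. of_nat (k choose i) *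
      chi (u + int i *s e2, u + int (k - i) *s e1))"
    unfolding binomial_ring sum_distrib_left
  proof (rule sum.cong)
    fix i
    have *: "(\<Sum>j<m. (a, b)) = (int m *s a, int m *s b)" for m and a b :: "int ^ 'a"
      by (induction m) (simp_all add: vec_eq_iff algebra_simps zero_prod_def)
    show "chi (u, u) * (of_nat (k choose i) * chi (e2, 0) ^ i * chi (0, e1) ^ (k - i)) =
      of_nat (k choose i) * (chi (u + int i *s e2, u + int (k - i) *s e1) :: _ \<Rightarrow>\<^sub>0 'b)"
      by (simp add: chi_power * chi_mult mult.left_commute[of "chi (u, u)"] mult.assoc)
  qed simp
  finally show ?thesis
    using assms by (simp add: mul_def eval_pair_sum eval_pair_of_nat_chi)
qed

end

theory Submission
  imports Defs
begin

text \<open>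
  On characters the multiplication reads
  \<open>\<chi>\<^sup>u(x * y) = \<Sum>i\<le>k. (k choose i) \<chi>\<^bsup>u + i e2\<^esup>(x) \<chi>\<^bsup>u + (k - i) e1\<^esup>(y)\<close> with
  \<open>k = \<langle>p, u\<rangle>\<close>, and a point is determined by its values on characters
  (\<open>point_expand\<close>). Everything is then read off from well-chosen \<open>u\<close>.

  \<^emph>\<open>Necessity.\<close> Let \<open>z\<close> be a zero element. If \<open>u \<noteq> 0\<close> is a lattice vector in
  \<open>\<sigma>\<^sup>\<bottom>\<close> (there is one as soon as \<open>\<sigma>\<^sup>\<bottom> \<noteq> 0\<close>), then \<open>k = 0\<close> and \<open>\<chi>\<^sup>u(z) = \<chi>\<^sup>u(z) \<chi>\<^sup>u(y)\<close> for every point \<open>y\<close>. Since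
  \<open>\<chi>\<^sup>u\<close> is invertible, \<open>\<chi>\<^sup>u(z) \<noteq> 0\<close>, so \<open>\<chi>\<^sup>u\<close> would be constantly 1, which fails at
  some point of the torus. If \<open>-e1\<close> lies in the dual cone, then \<open>k = 1\<close> for
  \<open>u = -e1\<close>, and multiplying \<open>z\<close> from the left by the point on which all characters
  are 1 gives \<open>\<chi>\<^sup>u(z) = 1 + \<chi>\<^sup>u(z)\<close>. The case of \<open>-e2\<close> is symmetric.

  \<^emph>\<open>Sufficiency.\<close> If \<open>\<sigma>\<^sup>\<bottom> = 0\<close>, then \<open>x_sigma\<close> vanishes on all characters except
  \<open>\<chi>\<^sup>0 = 1\<close>. A shifted exponent \<open>u + i e\<close>, where \<open>e\<close> is one of the two roots, is zero
  only for \<open>u = 0\<close> and \<open>i = 0\<close>, because otherwise \<open>-e = u / i\<close> would lie in the dual cone.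
  Hence only \<open>u = 0\<close> contributes to a product with \<open>x_sigma\<close>. A monoid has
  at most one zero, so \<open>x_sigma\<close> is the zero element whenever there is one.

  Both directions use that the exponents \<open>u + i e\<close> with \<open>i \<le> k\<close> stay in the semigroup
  (\<open>demazure_root_translate\<close>). The conditions defining a Demazure root only concern the
  primitive vectors on the rays, so this rests on the fact that a functional that is
  nonnegative on the rays of a strongly convex polyhedral cone is nonnegative on the whole
  cone. That is the geometric core (\<open>exists_ray_negative\<close>): a smallest face on which the
  functional takes a negative value turns out to be a ray.
\<close>

section \<open>The pairing\<close>

lemma scalar_product_lat: "scalar_product (lat v) (lat u) = of_int (scalar_product v u)"
  by (simp add: scalar_product_def lat_def)

lemma scalar_product_add_right:
  fixes x y z :: "'a::comm_ring_1 ^ 'n"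
  shows "scalar_product x (y + z) = scalar_product x y + scalar_product x z"
  by (simp add: scalar_product_def algebra_simps sum.distrib)

lemma scalar_product_scale_right:
  fixes x y :: "'a::comm_ring_1 ^ 'n"
  shows "scalar_product x (c *s y) = c * scalar_product x y"
  by (simp add: scalar_product_def sum_distrib_left mult.left_commute)

lemma scalar_product_minus_right:
  fixes x y :: "'a::comm_ring_1 ^ 'n"
  shows "scalar_product x (- y) = - scalar_product x y"
  by (simp add: scalar_product_def sum_negf)

lemma scalar_product_diff_right:
  fixes x y z :: "'a::comm_ring_1 ^ 'n"
  shows "scalar_product x (y - z) = scalar_product x y - scalar_product x z"
  by (simp add: scalar_product_def algebra_simps sum_subtractf)

lemma scalar_product_add_left:
  fixes x y z :: "'a::comm_ring_1 ^ 'n"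
  shows "scalar_product (x + y) z = scalar_product x z + scalar_product y z"
  by (simp add: scalar_product_def algebra_simps sum.distrib)

lemma scalar_product_scale_left:
  fixes x y :: "'a::comm_ring_1 ^ 'n"
  shows "scalar_product (c *s x) y = c * scalar_product x y"
  by (simp add: scalar_product_def sum_distrib_left mult.assoc)

lemma scalar_product_sum_left:
  fixes y :: "'a::comm_ring_1 ^ 'n"
  shows "scalar_product (\<Sum>i\<in>I. c i *s f i) y = (\<Sum>i\<in>I. c i * scalar_product (f i) y)"
proof (induction I rule: infinite_finite_induct)
  case (insert i I)
  then show ?case by (simp add: scalar_product_add_left scalar_product_scale_left)
qed (simp_all add: scalar_product_def)

lemmas scalar_product_linear =
  scalar_product_add_right scalar_product_scale_right scalar_product_minus_right
  scalar_product_diff_right scalar_product_add_left scalar_product_scale_left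

lemma scalar_product_axis_right: "scalar_product (x :: rat ^ 'n) (axis i 1) = x $ i"
  by (simp add: scalar_product_def axis_def if_distrib cong: if_cong)

lemma scalar_product_self_pos:
  assumes "(x :: rat ^ 'n) \<noteq> 0"
  shows "0 < scalar_product x x"
proof -
  obtain i where "x $ i \<noteq> 0"
    using assms by (auto simp: vec_eq_iff)
  then show ?thesis
    unfolding scalar_product_def by (intro sum_pos2[of _ i]) (auto simp: zero_less_mult_iff)
qed

lemma lat_add: "lat (u + v) = lat u + lat v"
  by (simp add: lat_def vec_eq_iff)

lemma lat_scale: "lat (k *s u) = of_int k *s lat u"
  by (simp add: lat_def vec_eq_iff)

lemma lat_eq_0_iff: "lat u = 0 \<longleftrightarrow> u = 0"
  by (simp add: lat_def vec_eq_iff)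

lemma lat_in_dual_cone_iff:
  "lat u \<in> dual_cone \<sigma> \<longleftrightarrow> u \<in> semigroup_of \<sigma>"
  by (simp add: semigroup_of_def)

section \<open>Strongly convex polyhedral cones are cut out by their rays\<close>

lemma uniform_small_multiple:
  fixes a b :: "'i \<Rightarrow> rat"
  assumes "finite I" "\<forall>i\<in>I. 0 < a i"
  shows "\<exists>\<epsilon>>0. \<forall>i\<in>I. \<epsilon> * b i < a i"
  using assms
proof (induction rule: finite_induct)
  case empty
  then show ?case by (auto intro: exI[of _ 1])
next
  case (insert j I)
  then obtain \<epsilon> where \<epsilon>: "\<epsilon> > 0" "\<forall>i\<in>I. \<epsilon> * b i < a i"
    by auto
  define \<delta> where "\<delta> = min \<epsilon> (a j / (2 * (\<bar>b j\<bar> + 1)))"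
  have "a j > 0"
    using insert.prems by simp
  then have \<delta>: "0 < \<delta>" "\<delta> \<le> \<epsilon>"
    using \<epsilon> by (auto simp: \<delta>_def)
  have "\<delta> * b i < a i" if "i \<in> I" for i
  proof (cases "0 \<le> b i")
    case True
    then have "\<delta> * b i \<le> \<epsilon> * b i"
      using \<delta> by (intro mult_right_mono) auto
    then show ?thesis
      using \<epsilon> that by force
  next
    case False
    then have "\<delta> * b i < 0"
      using \<delta> by (simp add: mult_less_0_iff)
    then show ?thesis
      using insert.prems that by force
  qed
  moreover have "\<delta> * b j < a j"
  proof -
    have "\<delta> * b j \<le> \<delta> * (\<bar>b j\<bar> + 1)"
      using \<delta> by (intro mult_left_mono) auto
    also have "\<dots> \<le> a j / (2 * (\<bar>b j\<bar> + 1)) * (\<bar>b j\<bar> + 1)"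
      by (intro mult_right_mono) (auto simp: \<delta>_def)
    also have "\<dots> = a j / 2"
    proof -
      have "\<bar>b j\<bar> + 1 \<noteq> 0" using abs_ge_zero[of "b j"] by linarith
      then show ?thesis by (simp add: field_simps)
    qed
    also have "\<dots> < a j"
      using \<open>a j > 0\<close> by simp
    finally show ?thesis .
  qed
  ultimately show ?case
    using \<delta> by (intro exI[of _ \<delta>]) auto
qed

text \<open>
  Gordan's alternative over the rationals, in the direction that produces a positive
  functional. The induction adds one vector \<open>f j\<close> to a family that is positive on \<open>u\<close>. If
  \<open>f j\<close> is negative on \<open>u\<close>, each other vector is projected along \<open>f j\<close> to the hyperplane
  where \<open>u\<close> vanishes; the projections are positive combinations of the given vectors, so they
  satisfy the hypothesis again. A functional positive on the projections may be changed by a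
  multiple of \<open>u\<close> without affecting them, until it takes a small positive value at \<open>f j\<close>.
  Families rather than sets are used because projections of distinct vectors may coincide.
\<close>

lemma gordan:
  fixes f :: "'i \<Rightarrow> rat ^ 'n"
  assumes "finite I"
    and "\<And>c. \<forall>i\<in>I. 0 \<le> c i \<Longrightarrow> (\<Sum>i\<in>I. c i *s f i) = 0 \<Longrightarrow> \<forall>i\<in>I. c i = 0"
  shows "\<exists>u. \<forall>i\<in>I. 0 < scalar_product (f i) u"
  using assms
proof (induction I arbitrary: f rule: finite_induct)
  case empty
  then show ?case by simp
next
  case (insert j I)
  have ne: "f j \<noteq> 0"
  proof
    assume "f j = 0"
    have *: "(\<Sum>i\<in>I. (if i = j then 1 else 0) *s f i) = 0"
      using insert.hyps by (intro sum.neutral) auto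
    have "\<forall>i\<in>insert j I. (if i = j then 1 else 0 :: rat) = 0"
      using insert.hyps \<open>f j = 0\<close> * by (intro insert.prems) auto
    then show False by auto
  qed
  have "\<exists>u. \<forall>i\<in>I. 0 < scalar_product (f i) u"
  proof (rule insert.IH)
    fix c :: "'i \<Rightarrow> rat"
    assume c: "\<forall>i\<in>I. 0 \<le> c i" "(\<Sum>i\<in>I. c i *s f i) = 0"
    have *: "(\<Sum>i\<in>I. (c(j := 0)) i *s f i) = (\<Sum>i\<in>I. c i *s f i)"
      using insert.hyps by (intro sum.cong) auto
    have "\<forall>i\<in>insert j I. (c(j := 0)) i = 0"
      using c insert.hyps * by (intro insert.prems) auto
    then show "\<forall>i\<in>I. c i = 0"
      using insert.hyps by (metis fun_upd_other insertCI)
  qed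
  then obtain u where u: "\<forall>i\<in>I. 0 < scalar_product (f i) u"
    by blast
  show ?case
  proof (cases "0 \<le> scalar_product (f j) u")
    case True
    \<comment> \<open>Here the self-pairing of \<open>f j\<close>, which is positive, repairs a possible zero value.\<close>
    obtain \<epsilon> where \<epsilon>: "\<epsilon> > 0"
        "\<forall>i\<in>I. \<epsilon> * (- scalar_product (f i) (f j)) < scalar_product (f i) u"
      using uniform_small_multiple[OF insert.hyps(1) u, of "\<lambda>i. - scalar_product (f i) (f j)"] by blast
    have "0 < scalar_product (f i) (u + \<epsilon> *s f j)" if "i \<in> insert j I" for i
    proof (cases "i = j")
      case True
      have "0 < \<epsilon> * scalar_product (f j) (f j)"
        using \<epsilon>(1) scalar_product_self_pos[OF ne] by simp
      then show ?thesis
        using \<open>0 \<le> _\<close> True by (simp add: scalar_product_linear)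
    next
      case False
      then show ?thesis
        using \<epsilon> that by (auto simp: scalar_product_linear)
    qed
    then show ?thesis by blast
  next
    case False
    define a where "a i = scalar_product (f i) u / - scalar_product (f j) u" for i
    have a: "a i > 0" if "i \<in> I" for i
      using u that False unfolding a_def by (intro divide_pos_pos) auto
    have "\<exists>u'. \<forall>i\<in>I. 0 < scalar_product (f i + a i *s f j) u'"
    proof (rule insert.IH)
      fix c :: "'i \<Rightarrow> rat"
      assume c: "\<forall>i\<in>I. 0 \<le> c i" "(\<Sum>i\<in>I. c i *s (f i + a i *s f j)) = 0"
      \<comment> \<open>A relation between the projections, rewritten as a relation between the \<open>f i\<close>.\<close>
      define d where "d = c(j := \<Sum>i\<in>I. c i * a i)"
      have "(\<Sum>i\<in>I. d i *s f i) = (\<Sum>i\<in>I. c i *s f i)"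
        using insert.hyps by (intro sum.cong) (auto simp: d_def)
      then have "(\<Sum>i\<in>insert j I. d i *s f i) = (\<Sum>i\<in>I. c i * a i) *s f j + (\<Sum>i\<in>I. c i *s f i)"
        using insert.hyps by (simp add: d_def)
      also have "\<dots> = (\<Sum>i\<in>I. c i *s (f i + a i *s f j))"
        by (simp add: vec.scale_right_distrib sum.distrib vec.scale_sum_left)
      finally have "(\<Sum>i\<in>insert j I. d i *s f i) = 0"
        using c by simp
      moreover have "\<forall>i\<in>insert j I. 0 \<le> d i"
        using c a by (auto simp: d_def less_imp_le intro!: sum_nonneg mult_nonneg_nonneg)
      ultimately have "\<forall>i\<in>insert j I. d i = 0"
        by (intro insert.prems)
      then show "\<forall>i\<in>I. c i = 0"
        using insert.hyps by (metis d_def fun_upd_other insertCI)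
    qed
    then obtain u' where u': "\<forall>i\<in>I. 0 < scalar_product (f i + a i *s f j) u'"
      by blast
    obtain \<epsilon> where \<epsilon>: "\<epsilon> > 0"
        "\<forall>i\<in>I. \<epsilon> * a i < scalar_product (f i + a i *s f j) u'"
      using uniform_small_multiple[OF insert.hyps(1) u', of a] by blast
    define t where "t = (\<epsilon> - scalar_product (f j) u') / scalar_product (f j) u"
    have j: "scalar_product (f j) (u' + t *s u) = \<epsilon>"
      using False by (simp add: scalar_product_linear t_def)
    have "0 < scalar_product (f i) (u' + t *s u)" if "i \<in> I" for i
    proof -
      have "scalar_product (f i + a i *s f j) u = 0"
        using False unfolding scalar_product_add_left scalar_product_scale_left a_def by simp
      then have "scalar_product (f i + a i *s f j) (u' + t *s u) = scalar_product (f i + a i *s f j) u'"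
        by (simp only: scalar_product_add_right scalar_product_scale_right)
      then have "scalar_product (f i) (u' + t *s u) = scalar_product (f i + a i *s f j) u' - a i * \<epsilon>"
        by (metis (no_types, lifting) add_diff_cancel_right' j scalar_product_add_left scalar_product_scale_left)
      then show ?thesis
        using \<epsilon> that by (simp add: mult.commute)
    qed
    then show ?thesis
      using j \<epsilon>(1) by (intro exI[of _ "u' + t *s u"]) auto
  qed
qed

lemma generator_in_cone_hull:
  assumes "finite S" "s \<in> S"
  shows "s \<in> cone_hull S"
proof -
  have "(\<Sum>v\<in>S. (if v = s then 1 else 0) *s v) = (\<Sum>v\<in>S. if v = s then s else 0)"
    by (intro sum.cong) auto
  also have "\<dots> = s"
    using assms by simp
  finally show ?thesis
    unfolding cone_hull_def by (force intro!: exI[of _ "\<lambda>v. if v = s then 1 else 0"])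
qed

lemma cone_hull_scale:
  assumes "v \<in> cone_hull S" "0 \<le> a"
  shows "a *s v \<in> cone_hull S"
proof -
  obtain c where c: "v = (\<Sum>s\<in>S. c s *s s)" "\<forall>s\<in>S. 0 \<le> c s"
    using assms(1) by (auto simp: cone_hull_def)
  have "a *s v = (\<Sum>s\<in>S. (a * c s) *s s)"
    by (simp add: c(1) vec.scale_sum_right)
  then show ?thesis
    unfolding cone_hull_def using c(2) assms(2) by (force intro!: exI[of _ "\<lambda>s. a * c s"])
qed

lemma dual_cone_hull:
  assumes "finite S"
  shows "dual_cone (cone_hull S) = {u. \<forall>s\<in>S. 0 \<le> scalar_product s u}"
proof -
  have "0 \<le> scalar_product (\<Sum>s\<in>S. c s *s s) u"
    if "\<forall>s\<in>S. 0 \<le> scalar_product s u" "\<forall>s\<in>S. 0 \<le> c s" for c u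
    using that by (auto simp: scalar_product_sum_left intro!: sum_nonneg)
  then show ?thesis
    using generator_in_cone_hull[OF assms]
    unfolding dual_cone_def by (auto simp: cone_hull_def)
qed

text \<open>
  A nontrivial relation \<open>\<Sum> c s *s s = 0\<close> with nonnegative coefficients would put some
  \<open>c t *s t \<noteq> 0\<close> and its negative, the sum of the other terms, both into the cone. So strong
  convexity is the hypothesis of Gordan's alternative.
\<close>

lemma strongly_convex_positive_functional:
  assumes "finite S" "strongly_convex (cone_hull S)"
  shows "\<exists>u. \<forall>s\<in>S - {0}. 0 < scalar_product s u"
proof (rule gordan[where f = "\<lambda>s. s"])
  show "finite (S - {0})"
    using assms by simp
next
  fix c
  assume c: "\<forall>s\<in>S - {0}. 0 \<le> c s" "(\<Sum>s\<in>S - {0}. c s *s s) = 0"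
  show "\<forall>s\<in>S - {0}. c s = 0"
  proof
    fix t
    assume t: "t \<in> S - {0}"
    define d where "d = (\<lambda>s. if s = 0 \<or> s = t then 0 else c s)"
    have "(\<Sum>s\<in>S. d s *s s) = (\<Sum>s\<in>S - {0} - {t}. c s *s s)"
      using assms(1) by (intro sum.mono_neutral_cong_right) (auto simp: d_def)
    then have "- (c t *s t) = (\<Sum>s\<in>S. d s *s s)"
      using c(2) t assms(1) sum.remove[of "S - {0}" t "\<lambda>s. c s *s s"]
      by (simp add: eq_neg_iff_add_eq_0 neg_eq_iff_add_eq_0)
    moreover have "(\<Sum>s\<in>S. d s *s s) \<in> cone_hull S"
      unfolding cone_hull_def using c(1) by (auto simp: d_def)
    ultimately have "c t *s t \<in> uminus ` cone_hull S"
      by (metis imageI minus_minus)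
    moreover have "c t *s t \<in> cone_hull S"
      using c(1) t generator_in_cone_hull[OF assms(1)] by (intro cone_hull_scale) auto
    ultimately have "c t *s t = 0"
      using assms(2) unfolding strongly_convex_def by blast
    then show "c t = 0"
      using t by simp
  qed
qed

text \<open>
  Among the nonzero lattice vectors on the half-line through \<open>t\<close>, which exist by clearing
  denominators, one of smallest \<open>\<ell>\<^sup>1\<close>-norm is primitive: were it \<open>k *s r\<close> with \<open>\<bar>k\<bar> > 1\<close>,
  then \<open>r\<close> or \<open>-r\<close> would lie on the same half-line and be shorter.
\<close>

lemma exists_primitive_multiple:
  assumes "(t :: rat ^ 'n) \<noteq> 0"
  shows "\<exists>q c. primitive q \<and> 0 < c \<and> lat q = c *s t"
proof -
  define P where "P q \<longleftrightarrow> q \<noteq> 0 \<and> (\<exists>c>0. lat q = c *s t)" for q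
  define size1 where "size1 q = nat (\<Sum>i\<in>UNIV. \<bar>q $ i\<bar>)" for q :: "int ^ 'n"
  have "\<exists>q. P q"
  proof -
    define d where "d i = snd (quotient_of (t $ i))" for i
    define D where "D = (\<Prod>i\<in>UNIV. d i)"
    have d: "d i > 0" for i
      by (simp add: d_def quotient_of_denom_pos')
    then have "D > 0"
      by (auto simp: D_def intro: prod_pos)
    have "\<exists>m. of_int D * t $ i = of_int m" for i
    proof -
      have "t $ i = of_int (fst (quotient_of (t $ i))) / of_int (d i)"
        by (simp add: d_def quotient_of_div)
      moreover have "D = d i * (\<Prod>j\<in>UNIV - {i}. d j)"
        by (simp add: D_def prod.remove)
      ultimately have "of_int D * t $ i = of_int (fst (quotient_of (t $ i)) * (\<Prod>j\<in>UNIV - {i}. d j))"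
        using d[of i] by (simp add: field_simps)
      then show ?thesis by blast
    qed
    then obtain m where m: "\<And>i. of_int D * t $ i = of_int (m i)"
      by metis
    have eq: "lat (\<chi> i. m i) = of_int D *s t"
      by (simp add: lat_def vec_eq_iff m)
    moreover have "of_int D *s t \<noteq> 0"
      using \<open>D > 0\<close> assms by simp
    ultimately have "P (\<chi> i. m i)"
      unfolding P_def using \<open>D > 0\<close> lat_eq_0_iff[of "\<chi> i. m i"]
      by (intro conjI exI[of _ "of_int D"]) auto
    then show ?thesis by blast
  qed
  then obtain q where q: "P q" "\<And>r. P r \<Longrightarrow> size1 q \<le> size1 r"
    using ex_has_least_nat[of P _ size1] by blast
  obtain c where c: "c > 0" "lat q = c *s t"
    using q(1) by (auto simp: P_def)
  have "\<bar>k\<bar> = 1" if "q = k *s r" for k r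
  proof (rule ccontr)
    assume "\<bar>k\<bar> \<noteq> 1"
    have "k \<noteq> 0" "r \<noteq> 0"
      using that q(1) by (auto simp: P_def)
    with \<open>\<bar>k\<bar> \<noteq> 1\<close> have k: "\<bar>k\<bar> \<ge> 2"
      by linarith
    define r' where "r' = sgn k *s r"
    have "q = \<bar>k\<bar> *s r'"
      by (simp add: that r'_def vec_eq_iff abs_sgn)
    then have "of_int \<bar>k\<bar> *s lat r' = c *s t"
      using c(2) lat_scale by metis
    then have "lat r' = (c / of_int \<bar>k\<bar>) *s t"
      using \<open>k \<noteq> 0\<close> by (simp add: vec_eq_iff field_simps)
    moreover have "r' \<noteq> 0"
      using \<open>k \<noteq> 0\<close> \<open>r \<noteq> 0\<close> by (auto simp: r'_def vec_eq_iff sgn_eq_0_iff)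
    ultimately have "P r'"
      unfolding P_def using c(1) \<open>k \<noteq> 0\<close>
      by (intro conjI exI[of _ "c / of_int \<bar>k\<bar>"]) auto
    have "(\<Sum>i\<in>UNIV. \<bar>q $ i\<bar>) = \<bar>k\<bar> * (\<Sum>i\<in>UNIV. \<bar>r' $ i\<bar>)"
      by (simp add: \<open>q = \<bar>k\<bar> *s r'\<close> abs_mult sum_distrib_left)
    moreover have "(\<Sum>i\<in>UNIV. \<bar>r' $ i\<bar>) > 0"
    proof -
      obtain i where "r' $ i \<noteq> 0"
        using \<open>r' \<noteq> 0\<close> by (auto simp: vec_eq_iff)
      then show ?thesis
        by (intro sum_pos2[of _ i]) auto
    qed
    ultimately have "(\<Sum>i\<in>UNIV. \<bar>q $ i\<bar>) > (\<Sum>i\<in>UNIV. \<bar>r' $ i\<bar>)"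
      using k by (smt (verit) mult_right_mono mult_cancel_right1)
    then have "size1 r' < size1 q"
      using \<open>0 < (\<Sum>i\<in>UNIV. \<bar>r' $ i\<bar>)\<close> by (simp add: size1_def)
    then show False
      using q(2)[OF \<open>P r'\<close>] by simp
  qed
  then show ?thesis
    using q(1) c unfolding primitive_def P_def by blast
qed

text \<open>
  Let \<open>u0\<close> be positive on all nonzero generators. For a functional \<open>g\<close>, the generators of a
  face at which the ratio of \<open>g\<close> to \<open>u0\<close> is smallest span a subface, on which \<open>g\<close> is
  proportional to \<open>u0\<close> (\<open>subface\<close> in the proof). Consider a face with the fewest generators
  among those on which \<open>w\<close> is somewhere negative. For \<open>g = w\<close> the smallest ratio is negative,
  so by minimality the subface is the whole face and \<open>w\<close> is a negative multiple of \<open>u0\<close> on it.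
  Consequently every nonzero subface has a generator with negative \<open>w\<close>, and minimality
  applies to every \<open>g\<close>: each coordinate is proportional to \<open>u0\<close> on the face, which is
  therefore one-dimensional.
\<close>

theorem exists_ray_negative:
  assumes "finite S" "strongly_convex (cone_hull S)" "w \<notin> dual_cone (cone_hull S)"
  shows "\<exists>\<rho> t. is_ray \<rho> (cone_hull S) \<and> t \<in> \<rho> \<and> scalar_product t w < 0"
proof -
  define \<sigma> where "\<sigma> = cone_hull S"
  obtain u0 where u0: "\<And>s. s \<in> S \<Longrightarrow> s \<noteq> 0 \<Longrightarrow> 0 < scalar_product s u0"
    using strongly_convex_positive_functional[OF assms(1,2)] by auto
  \<comment> \<open>A face is represented by a functional \<open>u\<close> in the dual cone that cuts it out, and its
    size is the number of nonzero generators that it contains.\<close>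
  define G where "G u = {s\<in>S. s \<noteq> 0 \<and> scalar_product s u = 0}" for u
  have finG: "finite (G u)" for u
    using assms(1) by (simp add: G_def)
  define P where "P u \<longleftrightarrow> u \<in> dual_cone \<sigma> \<and> (\<exists>s\<in>G u. scalar_product s w < 0)" for u
  have "\<exists>u. P u"
  proof -
    obtain s where "s \<in> S" "scalar_product s w < 0"
      using assms(1,3) by (auto simp: dual_cone_hull not_le)
    moreover from this have "s \<noteq> 0"
      by (auto simp: scalar_product_def)
    ultimately have "P 0"
      unfolding P_def G_def by (auto simp: dual_cone_def scalar_product_def intro!: bexI[of _ s])
    then show ?thesis ..
  qed
  then obtain u where u: "P u" "\<And>u'. P u' \<Longrightarrow> card (G u) \<le> card (G u')"
    using ex_has_least_nat[of P _ "\<lambda>u. card (G u)"] by blast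
  have u_dual: "u \<in> dual_cone \<sigma>"
    using u(1) by (simp add: P_def)
  define ratio where "ratio g s = scalar_product s g / scalar_product s u0" for g s
  have pos: "0 < scalar_product s u0" if "s \<in> G u" for s
    using that u0 by (auto simp: G_def)
  have subface: "\<exists>u'\<in>dual_cone \<sigma>. G u' = {s\<in>G u. scalar_product s g = \<mu> * scalar_product s u0}"
    if "\<mu> = Min (ratio g ` G u)" for g \<mu>
  proof -
    define h where "h = g - \<mu> *s u0"
    have h: "0 \<le> scalar_product s h" if "s \<in> G u" for s
    proof -
      have "\<mu> \<le> ratio g s"
        using finG that \<open>\<mu> = _\<close> by simp
      then show ?thesis
        using pos[OF that] by (simp add: h_def ratio_def scalar_product_linear field_simps)
    qed
    have "finite (S - {0} - G u)"
      using assms(1) by simp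
    moreover have "0 < scalar_product s u" if "s \<in> S - {0} - G u" for s
    proof -
      have "0 \<le> scalar_product s u"
        using that u_dual generator_in_cone_hull[OF assms(1)] by (auto simp: dual_cone_def \<sigma>_def)
      then show ?thesis
        using that by (auto simp: G_def)
    qed
    ultimately obtain \<epsilon> where \<epsilon>: "\<epsilon> > 0"
      "\<forall>s\<in>S - {0} - G u. \<epsilon> * (- scalar_product s h) < scalar_product s u"
      using uniform_small_multiple[of "S - {0} - G u" "\<lambda>s. scalar_product s u" "\<lambda>s. - scalar_product s h"]
      by blast
    \<comment> \<open>A small multiple of \<open>h\<close> keeps \<open>u\<close> positive off the face and cuts the face down to the
      zeros of \<open>h\<close>.\<close>
    define u' where "u' = u + \<epsilon> *s h"
    have off: "0 < scalar_product s u'" if "s \<in> S - {0} - G u" for s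
      using \<epsilon>(2) that by (force simp: u'_def scalar_product_linear)
    have on: "scalar_product s u' = \<epsilon> * scalar_product s h" if "s \<in> G u" for s
      using that by (simp add: u'_def G_def scalar_product_linear)
    have "0 \<le> scalar_product s u'" if "s \<in> S" for s
    proof -
      consider "s = 0" | "s \<in> G u" | "s \<in> S - {0} - G u"
        using \<open>s \<in> S\<close> by blast
      then show ?thesis
      proof cases
        case 1
        then show ?thesis by (simp add: scalar_product_def)
      next
        case 2
        then show ?thesis using on h \<epsilon>(1) by simp
      next
        case 3
        then show ?thesis using off less_imp_le by blast
      qed
    qed
    then have "u' \<in> dual_cone \<sigma>"
      by (simp add: \<sigma>_def dual_cone_hull[OF assms(1)])
    moreover have "s \<in> G u' \<longleftrightarrow> s \<in> G u \<and> scalar_product s g = \<mu> * scalar_product s u0" for s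
    proof (cases "s \<in> G u")
      case True
      then have "s \<in> S" "s \<noteq> 0" by (auto simp: G_def)
      then have "s \<in> G u' \<longleftrightarrow> scalar_product s h = 0"
        using on[OF True] \<epsilon>(1) by (simp add: G_def)
      then show ?thesis
        using True by (simp add: h_def scalar_product_linear)
    next
      case False
      have "s \<notin> G u'"
      proof
        assume "s \<in> G u'"
        then have "s \<in> S - {0} - G u" "scalar_product s u' = 0"
          using False by (auto simp: G_def)
        then show False using off by force
      qed
      then show ?thesis using False by simp
    qed
    ultimately show ?thesis by blast
  qed
  have attained: "\<exists>s\<in>G u. scalar_product s g = \<mu> * scalar_product s u0 \<and> (\<forall>r\<in>G u. \<mu> \<le> ratio g r)"
    if "\<mu> = Min (ratio g ` G u)" for g \<mu>
  proof -
    have "ratio g ` G u \<noteq> {}"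
      using u(1) by (auto simp: P_def)
    then have "\<mu> \<in> ratio g ` G u"
      using finG that by simp
    then obtain s where s: "s \<in> G u" "\<mu> = ratio g s"
      by blast
    then have "scalar_product s g = \<mu> * scalar_product s u0"
      using pos[of s] by (simp add: ratio_def)
    moreover have "\<mu> \<le> ratio g r" if "r \<in> G u" for r
      using that finG \<open>\<mu> = Min _\<close> by simp
    ultimately show ?thesis
      using s(1) by blast
  qed
  have proportional: "\<forall>s\<in>G u. scalar_product s g = \<mu> * scalar_product s u0"
    if \<mu>: "\<mu> = Min (ratio g ` G u)"
      and s: "s \<in> G u" "scalar_product s g = \<mu> * scalar_product s u0" "scalar_product s w < 0" for g \<mu> s
  proof -
    obtain u' where u': "u' \<in> dual_cone \<sigma>"
        "G u' = {s\<in>G u. scalar_product s g = \<mu> * scalar_product s u0}"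
      using subface[OF \<mu>] by blast
    then have "P u'"
      using s by (auto simp: P_def)
    then have "card (G u) \<le> card (G u')"
      by (rule u(2))
    then have "G u' = G u"
      using u'(2) finG by (intro card_seteq) auto
    then show ?thesis
      using u'(2) by blast
  qed
  have w_neg: "scalar_product s w < 0" if "s \<in> G u" for s
  proof -
    define \<mu> where "\<mu> = Min (ratio w ` G u)"
    obtain s0 where s0: "s0 \<in> G u" "scalar_product s0 w < 0"
      using u(1) by (auto simp: P_def)
    obtain s1 where s1: "s1 \<in> G u" "scalar_product s1 w = \<mu> * scalar_product s1 u0"
        "\<mu> \<le> ratio w s0"
      using attained[OF \<mu>_def] s0 by blast
    have "ratio w s0 < 0"
      using s0 pos by (simp add: ratio_def divide_neg_pos)
    then have "\<mu> < 0"
      using s1 by simp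
    then have "scalar_product s1 w < 0"
      using s1 pos by (simp add: mult_neg_pos)
    then have "scalar_product s w = \<mu> * scalar_product s u0"
      using proportional[OF \<mu>_def s1(1,2)] that by blast
    then show ?thesis
      using \<open>\<mu> < 0\<close> pos[OF that] by (simp add: mult_neg_pos)
  qed
  obtain t where t: "t \<in> G u"
    using u(1) by (auto simp: P_def)
  have parallel: "s \<in> vec.span {t}" if "s \<in> G u" for s
  proof -
    have "s $ i = scalar_product s u0 / scalar_product t u0 * t $ i" for i
    proof -
      define \<mu> where "\<mu> = Min (ratio (axis i 1) ` G u)"
      obtain s1 where "s1 \<in> G u" "scalar_product s1 (axis i 1) = \<mu> * scalar_product s1 u0"
        using attained[OF \<mu>_def] by blast
      then have "\<forall>r\<in>G u. scalar_product r (axis i 1) = \<mu> * scalar_product r u0"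
        using proportional[OF \<mu>_def] w_neg by blast
      then have "s $ i = \<mu> * scalar_product s u0" "t $ i = \<mu> * scalar_product t u0"
        using that t by (auto simp: scalar_product_axis_right)
      then show ?thesis
        using pos[OF t] by simp
    qed
    then have "s = (scalar_product s u0 / scalar_product t u0) *s t"
      by (simp add: vec_eq_iff)
    then show ?thesis
      by (metis insertI1 vec.span_base vec.span_scale)
  qed
  define \<rho> where "\<rho> = {v \<in> \<sigma>. scalar_product v u = 0}"
  have "\<rho> \<subseteq> vec.span {t}"
  proof
    fix v
    assume "v \<in> \<rho>"
    then obtain c where c: "v = (\<Sum>s\<in>S. c s *s s)" "\<forall>s\<in>S. 0 \<le> c s"
      and v: "scalar_product v u = 0"
      by (auto simp: \<rho>_def \<sigma>_def cone_hull_def)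
    have nonneg: "0 \<le> c s * scalar_product s u" if "s \<in> S" for s
      using u_dual c(2) that by (simp add: \<sigma>_def dual_cone_hull[OF assms(1)])
    have "(\<Sum>s\<in>S. c s * scalar_product s u) = 0"
      using v by (simp add: c(1) scalar_product_sum_left)
    then have zero: "\<forall>s\<in>S. c s * scalar_product s u = 0"
      using sum_nonneg_eq_0_iff[of S "\<lambda>s. c s * scalar_product s u"] assms(1) nonneg by simp
    have "c s *s s \<in> vec.span {t}" if "s \<in> S" for s
    proof (cases "s \<in> G u")
      case True
      then show ?thesis by (intro vec.span_scale parallel)
    next
      case False
      then have "c s *s s = 0"
        using zero that by (auto simp: G_def)
      then show ?thesis by (simp only: vec.span_zero)
    qed
    then show "v \<in> vec.span {t}"
      unfolding c(1) by (rule vec.span_sum)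
  qed
  moreover have "t \<in> \<rho>" "t \<noteq> 0"
    using t generator_in_cone_hull[OF assms(1)] by (auto simp: G_def \<rho>_def \<sigma>_def)
  ultimately have "vec.dim \<rho> = 1"
    by (intro vec.dim_unique[of "{t}"]) auto
  then have "is_ray \<rho> \<sigma>"
    unfolding is_ray_def is_face_def using u_dual \<rho>_def by blast
  then show ?thesis
    using \<open>t \<in> \<rho>\<close> w_neg[OF t] \<sigma>_def by blast
qed

lemma semigroup_of_if_nonneg_on_rays:
  assumes "polyhedral_cone \<sigma>" "strongly_convex \<sigma>"
    and nonneg: "\<And>\<rho> q. is_ray \<rho> \<sigma> \<Longrightarrow> primitive_on_ray q \<rho> \<Longrightarrow> 0 \<le> scalar_product q w"
  shows "w \<in> semigroup_of \<sigma>"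
proof (rule ccontr)
  assume "w \<notin> semigroup_of \<sigma>"
  then have w: "lat w \<notin> dual_cone \<sigma>"
    by (simp add: semigroup_of_def)
  obtain S where S: "finite S" "\<sigma> = cone_hull S"
    using assms(1) by (auto simp: polyhedral_cone_def)
  obtain \<rho> t where \<rho>: "is_ray \<rho> \<sigma>" "t \<in> \<rho>" "scalar_product t (lat w) < 0"
    using exists_ray_negative[of S "lat w"] assms(2) w S by blast
  then have "t \<noteq> 0"
    by (auto simp: scalar_product_def)
  then obtain q c where q: "primitive q" "0 < c" "lat q = c *s t"
    using exists_primitive_multiple by blast
  have "lat q \<in> \<rho>"
    using \<rho>(1,2) q(2,3) cone_hull_scale[of t S c]
    by (auto simp: is_ray_def is_face_def S(2) scalar_product_scale_left)
  then have "0 \<le> scalar_product q w"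
    using nonneg \<rho>(1) q(1) by (simp add: primitive_on_ray_def)
  moreover have "of_int (scalar_product q w) = c * scalar_product t (lat w)"
    by (simp add: q(3) scalar_product_scale_left flip: scalar_product_lat)
  then have "of_int (scalar_product q w) < (0 :: rat)"
    using q(2) \<rho>(3) by (simp add: mult_pos_neg)
  ultimately show False by simp
qed

text \<open>
  Adding \<open>e\<close> lowers the pairing with \<open>p\<close> by one at a time and lowers no pairing with the
  other rays, so the translate stays nonnegative on all rays as long as \<open>i\<close> does not exceed
  \<open>\<langle>p, u\<rangle>\<close>.
\<close>

lemma demazure_root_translate:
  assumes "polyhedral_cone \<sigma>" "strongly_convex \<sigma>" "demazure_root \<sigma> p e"
    and u: "u \<in> semigroup_of \<sigma>" and i: "int i \<le> scalar_product p u"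
  shows "u + int i *s e \<in> semigroup_of \<sigma>"
proof (rule semigroup_of_if_nonneg_on_rays[OF assms(1,2)])
  fix \<rho> q
  assume \<rho>: "is_ray \<rho> \<sigma>" "primitive_on_ray q \<rho>"
  show "0 \<le> scalar_product q (u + int i *s e)"
  proof (cases "q = p")
    case True
    then show ?thesis
      using i assms(3) by (simp add: demazure_root_def scalar_product_linear)
  next
    case False
    have "lat q \<in> \<sigma>"
      using \<rho> by (auto simp: is_ray_def is_face_def primitive_on_ray_def)
    then have "0 \<le> scalar_product (lat q) (lat u)"
      using u by (auto simp: semigroup_of_def dual_cone_def)
    then have "0 \<le> scalar_product q u"
      by (simp add: scalar_product_lat)
    moreover have "0 \<le> scalar_product q e"
      using assms(3) \<rho> False by (auto simp: demazure_root_def)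
    ultimately show ?thesis
      by (simp add: scalar_product_linear)
  qed
qed


section \<open>Points and semigroup homomorphisms\<close>

lemma poly_mapping_eq_sum_single:
  "f = (\<Sum>u\<in>Poly_Mapping.keys f. Poly_Mapping.single u (Poly_Mapping.lookup f u))"
  by (rule poly_mapping_eqI)
     (simp add: lookup_sum lookup_single when_def in_keys_iff)

lemma coord_ring_add: "f \<in> coord_ring \<sigma> \<Longrightarrow> g \<in> coord_ring \<sigma> \<Longrightarrow> f + g \<in> coord_ring \<sigma>"
  using Poly_Mapping.keys_add[of f g] by (auto simp: coord_ring_def)

lemma semigroup_of_zero: "0 \<in> semigroup_of \<sigma>"
  by (simp add: semigroup_of_def dual_cone_def lat_def scalar_product_def)

lemma semigroup_of_add: "u \<in> semigroup_of \<sigma> \<Longrightarrow> v \<in> semigroup_of \<sigma> \<Longrightarrow> u + v \<in> semigroup_of \<sigma>"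
  by (simp add: semigroup_of_def dual_cone_def lat_add scalar_product_add_right)

lemma coord_ring_mult:
  assumes "f \<in> coord_ring \<sigma>" "g \<in> coord_ring \<sigma>"
  shows "f * g \<in> coord_ring \<sigma>"
  using Poly_Mapping.keys_mult[of f g] assms semigroup_of_add
  unfolding coord_ring_def by fast

lemma coord_ring_single: "u \<in> semigroup_of \<sigma> \<Longrightarrow> Poly_Mapping.single u c \<in> coord_ring \<sigma>"
  by (auto simp: coord_ring_def)

lemma coord_ring_sum:
  assumes "\<And>i. i \<in> I \<Longrightarrow> F i \<in> coord_ring \<sigma>"
  shows "sum F I \<in> coord_ring \<sigma>"
  using assms
proof (induction I rule: infinite_finite_induct)
  case (insert i I)
  then show ?case by (simp add: coord_ring_add)
qed (simp_all add: coord_ring_def)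

lemma point_of_hom_chi:
  "u \<in> semigroup_of \<sigma> \<Longrightarrow> point_of_hom \<sigma> \<gamma> (chi u) = \<gamma> u"
  by (simp add: point_of_hom_def) (simp add: chi_def)

text \<open>
  The linear extension of a semigroup homomorphism to the coordinate algebra is
  multiplicative because both factors may be expanded into monomials. This is the source of
  the explicit points used below: \<open>x_sigma\<close> and two points of the torus.
\<close>

lemma point_of_hom_in_points:
  fixes \<gamma> :: "int ^ 'n \<Rightarrow> 'k::field"
  assumes one: "\<gamma> 0 = 1"
    and mult: "\<And>u v. u \<in> semigroup_of \<sigma> \<Longrightarrow> v \<in> semigroup_of \<sigma> \<Longrightarrow> \<gamma> (u + v) = \<gamma> u * \<gamma> v"
  shows "point_of_hom \<sigma> \<gamma> \<in> points \<sigma>"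
proof -
  define L where "L f = (\<Sum>u\<in>Poly_Mapping.keys f. Poly_Mapping.lookup f u * \<gamma> u)"
    for f :: "(int ^ 'n) \<Rightarrow>\<^sub>0 'k"
  have L_add: "L (f + g) = L f + L g" for f g
    unfolding L_def by (rule setsum_keys_plus_distrib) (simp_all add: algebra_simps)
  have L_0: "L 0 = 0"
    by (simp add: L_def)
  have L_sum: "L (sum F I) = (\<Sum>i\<in>I. L (F i))" for F :: "int ^ 'n \<Rightarrow> _" and I
    by (induction I rule: infinite_finite_induct) (simp_all add: L_add L_0)
  have L_single: "L (Poly_Mapping.single u c) = c * \<gamma> u" for u c
    by (simp add: L_def)
  have L_mult: "L (f * g) = L f * L g" if "f \<in> coord_ring \<sigma>" "g \<in> coord_ring \<sigma>" for f g
  proof -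
    have "f * g = (\<Sum>u\<in>Poly_Mapping.keys f. \<Sum>v\<in>Poly_Mapping.keys g.
        Poly_Mapping.single (u + v) (Poly_Mapping.lookup f u * Poly_Mapping.lookup g v))"
      by (subst poly_mapping_eq_sum_single[of f], subst poly_mapping_eq_sum_single[of g])
         (simp add: sum_product mult_single)
    then have "L (f * g) = (\<Sum>u\<in>Poly_Mapping.keys f. \<Sum>v\<in>Poly_Mapping.keys g.
        Poly_Mapping.lookup f u * Poly_Mapping.lookup g v * \<gamma> (u + v))"
      by (simp add: L_sum L_single)
    also have "\<dots> = (\<Sum>u\<in>Poly_Mapping.keys f. \<Sum>v\<in>Poly_Mapping.keys g.
        (Poly_Mapping.lookup f u * \<gamma> u) * (Poly_Mapping.lookup g v * \<gamma> v))"
    proof (intro sum.cong refl)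
      fix u v
      assume "u \<in> Poly_Mapping.keys f" "v \<in> Poly_Mapping.keys g"
      then have "\<gamma> (u + v) = \<gamma> u * \<gamma> v"
        using that by (intro mult) (auto simp: coord_ring_def)
      then show "Poly_Mapping.lookup f u * Poly_Mapping.lookup g v * \<gamma> (u + v) =
          (Poly_Mapping.lookup f u * \<gamma> u) * (Poly_Mapping.lookup g v * \<gamma> v)"
        by (simp only: mult_ac)
    qed
    finally show ?thesis
      by (simp add: L_def sum_product)
  qed
  have "point_of_hom \<sigma> \<gamma> = restrict L (coord_ring \<sigma>)"
    unfolding point_of_hom_def L_def ..
  then show ?thesis
    by (simp add: points_def coord_ring_single semigroup_of_zero coord_ring_add coord_ring_mult
        L_add L_mult L_single one)
qed

text \<open>
  The passage from algebra homomorphisms back to semigroup homomorphisms: identities between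
  points need to be verified on characters only.
\<close>

lemma point_expand:
  fixes x :: "((int ^ 'n) \<Rightarrow>\<^sub>0 'k::field) \<Rightarrow> 'k"
  assumes x: "x \<in> points \<sigma>" and f: "f \<in> coord_ring \<sigma>"
  shows "x f = (\<Sum>u\<in>Poly_Mapping.keys f. Poly_Mapping.lookup f u * x (chi u))"
proof -
  have x_const: "x (Poly_Mapping.single 0 c) = c" for c
    using x by (simp add: points_def)
  have x_add: "x (g + h) = x g + x h" and x_mult: "x (g * h) = x g * x h"
    if "g \<in> coord_ring \<sigma>" "h \<in> coord_ring \<sigma>" for g h
    using x that by (auto simp: points_def)
  have x_0: "x 0 = 0"
    using x_const[of 0] by simp
  have x_sum: "x (sum F I) = (\<Sum>i\<in>I. x (F i))"
    if "\<And>i. i \<in> I \<Longrightarrow> F i \<in> coord_ring \<sigma>" for F :: "int ^ 'n \<Rightarrow> _" and I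
    using that
    by (induction I rule: infinite_finite_induct) (simp_all add: x_add x_0 coord_ring_sum)
  have x_single: "x (Poly_Mapping.single u c) = c * x (chi u)" if "u \<in> semigroup_of \<sigma>" for u c
  proof -
    have "Poly_Mapping.single u c = Poly_Mapping.single 0 c * chi u"
      by (simp add: chi_def mult_single)
    then show ?thesis
      using that by (simp add: x_mult x_const coord_ring_single semigroup_of_zero)
  qed
  have keys: "u \<in> semigroup_of \<sigma>" if "u \<in> Poly_Mapping.keys f" for u
    using f that by (auto simp: coord_ring_def)
  have "x f = x (\<Sum>u\<in>Poly_Mapping.keys f. Poly_Mapping.single u (Poly_Mapping.lookup f u))"
    by (simp flip: poly_mapping_eq_sum_single)
  also have "\<dots> = (\<Sum>u\<in>Poly_Mapping.keys f. x (Poly_Mapping.single u (Poly_Mapping.lookup f u)))"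
    by (intro x_sum coord_ring_single keys)
  also have "\<dots> = (\<Sum>u\<in>Poly_Mapping.keys f. Poly_Mapping.lookup f u * x (chi u))"
    by (intro sum.cong refl x_single keys)
  finally show ?thesis .
qed

lemma point_chi_zero: "x \<in> points \<sigma> \<Longrightarrow> x (chi 0) = 1"
  unfolding points_def chi_def by blast

lemma point_chi_add:
  assumes "x \<in> points \<sigma>" "u \<in> semigroup_of \<sigma>" "v \<in> semigroup_of \<sigma>"
  shows "x (chi (u + v)) = x (chi u) * x (chi v)"
proof -
  have "x (chi u * chi v) = x (chi u) * x (chi v)"
    using assms by (simp add: points_def)
  then show ?thesis
    by (simp add: chi_mult)
qed

lemma eval_pair_const_mult:
  "eval_pair x y (Poly_Mapping.single 0 c * F) = c * eval_pair x y F"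
proof -
  have lk: "Poly_Mapping.lookup (Poly_Mapping.single 0 c * F) a = c * Poly_Mapping.lookup F a" for a
    by (simp add: map.rep_eq when_def flip: mult_map_scale_conv_mult)
  then have "Poly_Mapping.keys (Poly_Mapping.single 0 c * F) \<subseteq> Poly_Mapping.keys F"
    by (auto simp: in_keys_iff)
  then have "eval_pair x y (Poly_Mapping.single 0 c * F) =
      (\<Sum>(a, b)\<in>Poly_Mapping.keys F. c * Poly_Mapping.lookup F (a, b) * x (chi a) * y (chi b))"
    by (simp add: eval_pair_superset[of "Poly_Mapping.keys F"] lk)
  then show ?thesis
    by (simp add: eval_pair_def sum_distrib_left split_beta mult.assoc)
qed

lemma mul_expand:
  assumes "f \<in> coord_ring \<sigma>"
  shows "mul \<sigma> p e1 e2 x y f =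
    (\<Sum>u\<in>Poly_Mapping.keys f. Poly_Mapping.lookup f u * mul \<sigma> p e1 e2 x y (chi u))"
proof -
  have "mul \<sigma> p e1 e2 x y (chi u) = eval_pair x y (comult_chi p e1 e2 u)"
    if "u \<in> Poly_Mapping.keys f" for u
  proof -
    have "u \<in> semigroup_of \<sigma>"
      using that assms by (auto simp: coord_ring_def)
    then have "mul \<sigma> p e1 e2 x y (chi u) = eval_pair x y (comult p e1 e2 (chi u))"
      by (simp add: mul_def)
    then show ?thesis
      by (simp add: comult_def chi_def)
  qed
  then show ?thesis
    using assms by (simp add: mul_def comult_def eval_pair_sum eval_pair_const_mult)
qed

lemma mul_eq_point_iff:
  fixes z :: "((int ^ 'n) \<Rightarrow>\<^sub>0 'k::field) \<Rightarrow> 'k"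
  assumes "z \<in> points \<sigma>"
  shows "mul \<sigma> p e1 e2 x y = z \<longleftrightarrow>
    (\<forall>u\<in>semigroup_of \<sigma>. mul \<sigma> p e1 e2 x y (chi u) = z (chi u))"
proof
  assume eq: "\<forall>u\<in>semigroup_of \<sigma>. mul \<sigma> p e1 e2 x y (chi u) = z (chi u)"
  show "mul \<sigma> p e1 e2 x y = z"
  proof (rule extensionalityI[of _ "coord_ring \<sigma>"])
    show "mul \<sigma> p e1 e2 x y \<in> extensional (coord_ring \<sigma>)"
      by (simp add: mul_def)
    show "z \<in> extensional (coord_ring \<sigma>)"
      using assms by (simp add: points_def)
    fix f :: "(int ^ 'n) \<Rightarrow>\<^sub>0 'k"
    assume f: "f \<in> coord_ring \<sigma>"
    show "mul \<sigma> p e1 e2 x y f = z f"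
      unfolding mul_expand[OF f] point_expand[OF assms f]
      using eq f by (intro sum.cong) (auto simp: coord_ring_def)
  qed
qed simp

section \<open>The zero element\<close>

text \<open>
  The indicator of \<open>\<sigma>\<^sup>\<bottom>\<close> is multiplicative on the semigroup, since a sum of two functionals
  that are nonnegative on \<open>\<sigma>\<close> vanishes on \<open>\<sigma>\<close> only if both do.
\<close>

lemma x_sigma_in_points: "x_sigma \<sigma> \<in> points \<sigma>"
  unfolding x_sigma_def
proof (rule point_of_hom_in_points)
  fix u v
  assume "u \<in> semigroup_of \<sigma>" "v \<in> semigroup_of \<sigma>"
  then have "lat (u + v) \<in> perp \<sigma> \<longleftrightarrow> lat u \<in> perp \<sigma> \<and> lat v \<in> perp \<sigma>"
    by (auto simp: perp_def semigroup_of_def dual_cone_def lat_add scalar_product_add_right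
        add_nonneg_eq_0_iff)
  then show "(if lat (u + v) \<in> perp \<sigma> then 1 else 0) =
      (if lat u \<in> perp \<sigma> then 1 else 0) * (if lat v \<in> perp \<sigma> then 1 else (0 :: 'b))"
    by simp
qed (simp add: perp_def lat_def scalar_product_def)

lemma is_zero_element_unique:
  "is_zero_element X m z \<Longrightarrow> is_zero_element X m z' \<Longrightarrow> z = z'"
  unfolding is_zero_element_def by metis

text \<open>
  If \<open>u + i e = 0\<close> with \<open>i > 0\<close>, then \<open>-e\<close> is a positive multiple of \<open>u\<close>, hence in the dual cone.
\<close>

lemma translate_eq_0_iff:
  assumes "u \<in> semigroup_of \<sigma>" "lat (- e) \<notin> dual_cone \<sigma>"
  shows "u + int i *s e = 0 \<longleftrightarrow> u = 0 \<and> i = 0"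
proof
  assume eq: "u + int i *s e = 0"
  have "i = 0"
  proof (rule ccontr)
    assume "i \<noteq> 0"
    have "u = int i *s (- e)"
      using eq by (simp add: eq_neg_iff_add_eq_0 vector_ssub_ldistrib)
    then have "lat u = of_nat i *s lat (- e)"
      using lat_scale by (metis of_int_of_nat_eq)
    then have "0 \<le> scalar_product v (lat (- e))" if "v \<in> \<sigma>" for v
      using assms(1) that \<open>i \<noteq> 0\<close>
      by (auto simp: semigroup_of_def dual_cone_def scalar_product_scale_right zero_le_mult_iff)
    then show False
      using assms(2) by (simp add: dual_cone_def)
  qed
  then show "u = 0 \<and> i = 0"
    using eq by simp
qed simp

text \<open>
  The point \<open>y\<close> below lies in the torus: it is the one-parameter point with value 2 at the
  \<open>j\<close>-th coordinate, for a coordinate \<open>j\<close> in which \<open>u\<close> is nonzero. In characteristic zero,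
  2 is not a root of unity, so the character \<open>\<chi>\<^sup>u\<close> is not 1 at \<open>y\<close>.
\<close>

lemma perp_trivial_if_zero_element:
  fixes z :: "((int ^ 'n) \<Rightarrow>\<^sub>0 'k::field_char_0) \<Rightarrow> 'k"
  assumes "lat p \<in> \<sigma>" and z: "is_zero_element (points \<sigma>) (mul \<sigma> p e1 e2) z"
  shows "perp \<sigma> = {0}"
proof (rule ccontr)
  assume "perp \<sigma> \<noteq> {0}"
  moreover have "0 \<in> perp \<sigma>"
    by (simp add: perp_def scalar_product_def)
  ultimately obtain w where w: "w \<in> perp \<sigma>" "w \<noteq> 0"
    by blast
  then obtain u c where u: "primitive u" "lat u = c *s w"
    using exists_primitive_multiple by blast
  have u_perp: "\<And>v. v \<in> \<sigma> \<Longrightarrow> scalar_product v (lat u) = 0"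
    using w(1) by (simp add: u(2) perp_def scalar_product_scale_right)
  moreover have "lat (- u) = - lat u"
    by (simp add: lat_def vec_eq_iff)
  ultimately have S: "u \<in> semigroup_of \<sigma>" "- u \<in> semigroup_of \<sigma>"
    by (simp_all add: semigroup_of_def dual_cone_def scalar_product_minus_right)
  have pu: "scalar_product p u = 0"
    using u_perp[OF assms(1)] by (simp add: scalar_product_lat)
  obtain j where j: "u $ j \<noteq> 0"
    using u(1) by (auto simp: primitive_def vec_eq_iff)
  define y :: "((int ^ 'n) \<Rightarrow>\<^sub>0 'k) \<Rightarrow> 'k" where "y = point_of_hom \<sigma> (\<lambda>u. 2 powi (u $ j))"
  have y: "y \<in> points \<sigma>"
    unfolding y_def by (rule point_of_hom_in_points) (simp_all add: power_int_add)
  have "mul \<sigma> p e1 e2 z y (chi u) = z (chi u) * y (chi u)"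
    using mul_chi[OF S(1) refl, of p e1 e2 z y] pu by simp
  then have "z (chi u) = z (chi u) * y (chi u)"
    using z y by (simp add: is_zero_element_def)
  moreover have "z (chi u) \<noteq> 0"
  proof
    assume "z (chi u) = 0"
    have "z \<in> points \<sigma>"
      using z by (simp add: is_zero_element_def)
    then have "z (chi (u + - u)) = 0"
      using \<open>z (chi u) = 0\<close> S by (simp only: point_chi_add) simp
    then show False
      using point_chi_zero[OF \<open>z \<in> points \<sigma>\<close>] by simp
  qed
  ultimately have "(2 :: 'k) powi (u $ j) = 1"
    by (simp add: y_def point_of_hom_chi[OF S(1)])
  then have "(2 :: 'k) ^ nat \<bar>u $ j\<bar> = 1"
    by (cases "u $ j \<ge> 0") (auto simp: power_int_def field_simps)
  then have "of_nat (2 ^ nat \<bar>u $ j\<bar>) = (of_nat 1 :: 'k)"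
    by simp
  then have "(2 :: nat) ^ nat \<bar>u $ j\<bar> = 1"
    by (simp only: of_nat_eq_iff)
  then show False
    using j by simp
qed

text \<open>
  At \<open>-e1\<close> and \<open>-e2\<close> the pairing with \<open>p\<close> is 1, so the product has just two terms
  (\<open>mul_root\<close> in the proof). With the point \<open>y\<close> on which every character is 1, one of them is
  \<open>\<chi>\<^sup>0 = 1\<close> and the other is the value of the zero element itself.
\<close>

lemma roots_not_negated_if_zero_element:
  fixes z :: "((int ^ 'n) \<Rightarrow>\<^sub>0 'k::field) \<Rightarrow> 'k"
  assumes "polyhedral_cone \<sigma>" "strongly_convex \<sigma>"
    and e: "demazure_root \<sigma> p e1" "demazure_root \<sigma> p e2"
    and z: "is_zero_element (points \<sigma>) (mul \<sigma> p e1 e2) z"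
  shows "- e1 \<notin> semigroup_of \<sigma> \<and> - e2 \<notin> semigroup_of \<sigma>"
proof -
  define y :: "((int ^ 'n) \<Rightarrow>\<^sub>0 'k) \<Rightarrow> 'k" where "y = point_of_hom \<sigma> (\<lambda>u. 1)"
  have y: "y \<in> points \<sigma>"
    unfolding y_def by (rule point_of_hom_in_points) simp_all
  have y1: "y (chi u) = 1" if "u \<in> semigroup_of \<sigma>" for u
    using that by (simp add: y_def point_of_hom_chi)
  have zp: "z \<in> points \<sigma>" and zy: "mul \<sigma> p e1 e2 z y = z" and yz: "mul \<sigma> p e1 e2 y z = z"
    using z y by (auto simp: is_zero_element_def)
  have p: "scalar_product p (- e1) = 1" "scalar_product p (- e2) = 1"
    using e by (simp_all add: demazure_root_def scalar_product_minus_right)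
  have mul_root: "mul \<sigma> p e1 e2 x x' (chi u) = x (chi u) * x' (chi (u + e1)) + x (chi (u + e2)) * x' (chi u)"
    if "u \<in> semigroup_of \<sigma>" "scalar_product p u = 1" for x x' u
    using mul_chi[OF that(1) refl, of p e1 e2 x x'] that(2) by (simp add: atMost_Suc add.commute)
  have "False" if S: "- e1 \<in> semigroup_of \<sigma>"
  proof -
    have "- e1 + e2 \<in> semigroup_of \<sigma>"
      using demazure_root_translate[OF assms(1,2) e(2) S, of 1] p by simp
    then have "z (chi (- e1)) = 1 + z (chi (- e1))"
      using mul_root[OF S p(1), of y z] yz zp S by (simp add: y1 point_chi_zero)
    then show False by simp
  qed
  moreover have "False" if S: "- e2 \<in> semigroup_of \<sigma>"
  proof -
    have "- e2 + e1 \<in> semigroup_of \<sigma>"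
      using demazure_root_translate[OF assms(1,2) e(1) S, of 1] p by simp
    then have "z (chi (- e2)) = z (chi (- e2)) + 1"
      using mul_root[OF S p(2), of z y] zy zp S by (simp add: y1 point_chi_zero)
    then show False by simp
  qed
  ultimately show ?thesis by blast
qed

text \<open>
  Only the summand with \<open>i = 0\<close> (respectively \<open>i = k\<close>) at \<open>u = 0\<close> survives in a product
  with \<open>x_sigma\<close>, and there \<open>k = 0\<close>.
\<close>

lemma x_sigma_is_zero_element:
  fixes \<sigma> :: "(rat ^ 'n) set"
  assumes "polyhedral_cone \<sigma>" "strongly_convex \<sigma>" and "lat p \<in> \<sigma>"
    and e: "demazure_root \<sigma> p e1" "demazure_root \<sigma> p e2"
    and perp: "perp \<sigma> = {0}"
    and not_dual: "lat (- e1) \<notin> dual_cone \<sigma>" "lat (- e2) \<notin> dual_cone \<sigma>"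
  shows "is_zero_element (points \<sigma>) (mul \<sigma> p e1 e2) (x_sigma \<sigma> :: _ \<Rightarrow> 'k::field)"
  unfolding is_zero_element_def
proof (intro conjI ballI)
  show "x_sigma \<sigma> \<in> points \<sigma>"
    by (rule x_sigma_in_points)
next
  fix x :: "((int ^ 'n) \<Rightarrow>\<^sub>0 'k) \<Rightarrow> 'k"
  assume x: "x \<in> points \<sigma>"
  have z_chi: "x_sigma \<sigma> (chi u) = (if u = 0 then 1 else (0 :: 'k))" if "u \<in> semigroup_of \<sigma>" for u
    using that by (simp add: x_sigma_chi perp lat_eq_0_iff)
  have pu: "0 \<le> scalar_product p u" if "u \<in> semigroup_of \<sigma>" for u
    using that assms(3) by (auto simp: semigroup_of_def dual_cone_def scalar_product_lat)
  have left: "mul \<sigma> p e1 e2 (x_sigma \<sigma>) x (chi u) = x_sigma \<sigma> (chi u)"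
    and right: "mul \<sigma> p e1 e2 x (x_sigma \<sigma>) (chi u) = x_sigma \<sigma> (chi u)"
    if u: "u \<in> semigroup_of \<sigma>" for u
  proof -
    define k where "k = nat (scalar_product p u)"
    have k: "int k = scalar_product p u"
      using pu[OF u] by (simp add: k_def)
    have k0: "k = 0" if "u = 0"
      using that by (simp add: k_def scalar_product_def)
    have val: "x_sigma \<sigma> (chi (u + int i *s e)) = (if u = 0 \<and> i = 0 then 1 else (0 :: 'k))"
      if "i \<le> k" "demazure_root \<sigma> p e" "lat (- e) \<notin> dual_cone \<sigma>" for i e
    proof -
      have "u + int i *s e \<in> semigroup_of \<sigma>"
        using demazure_root_translate[OF assms(1,2) that(2) u] that(1) k by simp
      then show ?thesis
        by (simp add: z_chi translate_eq_0_iff[OF u that(3)])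
    qed
    have "mul \<sigma> p e1 e2 (x_sigma \<sigma>) x (chi u) =
        (\<Sum>i\<le>k. of_nat (k choose i) * (if u = 0 \<and> i = 0 then 1 else 0) * x (chi (u + int (k - i) *s e1)))"
      unfolding mul_chi[OF u k_def] using val e not_dual by (intro sum.cong) auto
    also have "\<dots> = (if u = 0 then 1 else 0)"
      using k0 point_chi_zero[OF x] by auto
    finally show "mul \<sigma> p e1 e2 (x_sigma \<sigma>) x (chi u) = x_sigma \<sigma> (chi u)"
      by (simp add: z_chi[OF u])
    have "mul \<sigma> p e1 e2 x (x_sigma \<sigma>) (chi u) =
        (\<Sum>i\<le>k. of_nat (k choose i) * x (chi (u + int i *s e2)) * (if u = 0 \<and> k - i = 0 then 1 else 0))"
      unfolding mul_chi[OF u k_def]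
      by (intro sum.cong refl, subst val[OF _ e(1) not_dual(1)]) simp_all
    also have "\<dots> = (if u = 0 then 1 else 0)"
      using k0 point_chi_zero[OF x] by auto
    finally show "mul \<sigma> p e1 e2 x (x_sigma \<sigma>) (chi u) = x_sigma \<sigma> (chi u)"
      by (simp add: z_chi[OF u])
  qed
  show "mul \<sigma> p e1 e2 (x_sigma \<sigma>) x = x_sigma \<sigma>" "mul \<sigma> p e1 e2 x (x_sigma \<sigma>) = x_sigma \<sigma>"
    using left right by (simp_all add: mul_eq_point_iff[OF x_sigma_in_points])
qed

theorem proposition4:
  fixes \<sigma> \<rho> :: "(rat ^ 'n) set" and p e1 e2 :: "int ^ 'n"
    and X :: "(((int ^ 'n) \<Rightarrow>\<^sub>0 'k::{alg_closed_field, field_char_0}) \<Rightarrow> 'k) set"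
  assumes "polyhedral_cone \<sigma>" and "strongly_convex \<sigma>"
    and "is_ray \<rho> \<sigma>" and "primitive_on_ray p \<rho>"
    and "demazure_root \<sigma> p e1" and "demazure_root \<sigma> p e2"
    and "X = points \<sigma>"
  shows "((\<exists>z. is_zero_element X (mul \<sigma> p e1 e2) z) \<longleftrightarrow>
           perp \<sigma> = {0} \<and> lat (- e1) \<notin> dual_cone \<sigma> \<and> lat (- e2) \<notin> dual_cone \<sigma>) \<and>
         (\<forall>z. is_zero_element X (mul \<sigma> p e1 e2) z \<longrightarrow> z = x_sigma \<sigma>)"
proof -
  have p: "lat p \<in> \<sigma>"
    using assms(3,4) by (auto simp: is_ray_def is_face_def primitive_on_ray_def)
  have nec: "perp \<sigma> = {0} \<and> lat (- e1) \<notin> dual_cone \<sigma> \<and> lat (- e2) \<notin> dual_cone \<sigma>"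
    if "is_zero_element X (mul \<sigma> p e1 e2) z" for z
  proof -
    have z: "is_zero_element (points \<sigma>) (mul \<sigma> p e1 e2) z"
      using that assms(7) by simp
    show ?thesis
      using perp_trivial_if_zero_element[OF p z]
        roots_not_negated_if_zero_element[OF assms(1,2,5,6) z]
      by (simp add: lat_in_dual_cone_iff)
  qed
  have suf: "is_zero_element X (mul \<sigma> p e1 e2) (x_sigma \<sigma>)"
    if "perp \<sigma> = {0}" "lat (- e1) \<notin> dual_cone \<sigma>" "lat (- e2) \<notin> dual_cone \<sigma>"
    using x_sigma_is_zero_element[OF assms(1,2) p assms(5,6)] that assms(7) by simp
  show ?thesis
  proof (intro conjI iffI allI impI)
    fix z
    assume z: "is_zero_element X (mul \<sigma> p e1 e2) z"
    then show "z = x_sigma \<sigma>"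
      using nec[OF z] suf is_zero_element_unique[OF z] by blast
  next
    assume "\<exists>z. is_zero_element X (mul \<sigma> p e1 e2) z"
    then obtain z where z: "is_zero_element X (mul \<sigma> p e1 e2) z" ..
    show "perp \<sigma> = {0}" "lat (- e1) \<notin> dual_cone \<sigma>" "lat (- e2) \<notin> dual_cone \<sigma>"
      using nec[OF z] by blast+
  next
    assume "perp \<sigma> = {0} \<and> lat (- e1) \<notin> dual_cone \<sigma> \<and> lat (- e2) \<notin> dual_cone \<sigma>"
    then show "\<exists>z. is_zero_element X (mul \<sigma> p e1 e2) z"
      using suf by blast
  qed
qed

end
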